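(* Let $n\ge 1$ and $m\geq 1$ be integers, and let $H_m:\mathscr{S}(\mathbb{R}^n;E^{m-1}(n))\to\mathscr{S}(\mathbb{R}^n;E^{m}(n))$ be defined by $H_mh=\varepsilon(D^2h)$. Then $\operatorname{im}(H_m)\subset\ker(X^m)$.
   Context: For $m\ge 0$, $E^m(n)=(\mathbb{R}^n\otimes_{\mathrm s}\mathbb{R}^n)^{\otimes_{\mathrm s}m}$ is the space of elastic $m$-tensors: the $m$-th symmetric tensor power of the space of symmetric $2$-tensors on $\mathbb{R}^n$, i.e. tensors $a_{i_1j_1\cdots i_mj_m}$ of rank $2m$ that are invariant under swapping $i_r\leftrightarrow j_r$ for each $r$ and under permutations of the index pairs $(i_r,j_r)$; $E^0(n)$ is the scalars. $\varepsilon:(\mathbb{R}^n)^{\otimes 2m}\to E^m(n)$ is the corresponding symmetrization (averaging a tensor over all these index symmetries). $\mathscr{S}(\mathbb{R}^n;E)$ denotes Schwartz functions with values in $E$. For a tensor field $f$, $(Df)_{ji_1\cdots i_r}=\partial_jf_{i_1\cdots i_r}$ and $D^2f=D(Df)$. For $v\in\mathbb{S}^{n-1}$ let $Q(v)=\mathbb{R}v\cup v^\perp\subset\mathbb{R}^n$. For $f\in\mathscr{S}(\mathbb{R}^n;E^m(n))$, $x\in\mathbb{R}^n$, $v\in\mathbb{S}^{n-1}$, $q\in Q(v)$, $$X^m_{v,q}f(x)=\int_{\mathbb{R}}\langle f(x+tv),(v\otimes q)^{\otimes m}\rangle\,dt=\int_{\mathbb{R}}\sum f_{i_1j_1\cdots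 i_mj_m}(x+tv)\,v_{i_1}q_{j_1}\cdots v_{i_m}q_{j_m}\,dt,$$ and $\ker(X^m)$ is the set of $f\in\mathscr{S}(\mathbb{R}^n;E^m(n))$ with $X^m_{v,q}f=0$ for all $v\in\mathbb{S}^{n-1}$, $q\in Q(v)$. *)

theory Defs
  imports "HOL-Analysis.Analysis" "HOL-Combinatorics.Combinatorics"
begin

(* A tensor of rank r over real^'n is given by its components with respect to the
   standard basis, indexed by lists of length r; the components at lists of any other
   length are required to vanish, so that equality of tensors is equality of functions. *)

type_synonym 'n tensor = "'n list \<Rightarrow> real"

definition tensors :: "nat \<Rightarrow> 'n tensor set" where
  "tensors r = {a. \<forall>is. length is \<noteq> r \<longrightarrow> a is = 0}"

definition tensor_inner :: "nat \<Rightarrow> 'n::finite tensor \<Rightarrow> 'n tensor \<Rightarrow> real" where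
  "tensor_inner r a b = (\<Sum>is | length is = r. a is * b is)"

(* Components of a tensor of rank 2m are listed as [i_1, j_1, ..., i_m, j_m], so the r-th
   index pair (counting from 0) occupies the positions 2r and 2r+1. *)

definition pair_swap :: "nat \<Rightarrow> nat \<Rightarrow> nat" where
  "pair_swap r = Transposition.transpose (2 * r) (2 * r + 1)"

definition pair_perm :: "(nat \<Rightarrow> nat) \<Rightarrow> nat \<Rightarrow> nat" where
  "pair_perm \<sigma> k = 2 * \<sigma> (k div 2) + k mod 2"

definition elastic_tensors :: "nat \<Rightarrow> 'n tensor set" where
  "elastic_tensors m = {a \<in> tensors (2 * m).
     (\<forall>r<m. \<forall>is. length is = 2 * m \<longrightarrow> a (permute_list (pair_swap r) is) = a is) \<and>
     (\<forall>\<sigma> is. \<sigma> permutes {..<m} \<longrightarrow> length is = 2 * m \<longrightarrow>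
        a (permute_list (pair_perm \<sigma>) is) = a is)}"

(* The group generated by the index symmetries; being finite, it is already generated
   by them as a monoid. *)

inductive_set elastic_perms :: "nat \<Rightarrow> (nat \<Rightarrow> nat) set" for m :: nat where
  id: "id \<in> elastic_perms m"
| swap: "\<pi> \<in> elastic_perms m \<Longrightarrow> r < m \<Longrightarrow> \<pi> \<circ> pair_swap r \<in> elastic_perms m"
| perm: "\<pi> \<in> elastic_perms m \<Longrightarrow> \<sigma> permutes {..<m} \<Longrightarrow> \<pi> \<circ> pair_perm \<sigma> \<in> elastic_perms m"

lemma elastic_perms_permutes:
  assumes "\<pi> \<in> elastic_perms m"
  shows "\<pi> permutes {..<2 * m}"
  using assms
proof induction
  case id
  show ?case by (rule permutes_id)
next
  case (swap \<pi> r)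
  have "pair_swap r permutes {..<2 * m}"
    unfolding pair_swap_def using swap.hyps by (intro permutes_swap_id) auto
  then show ?case using swap.IH by (rule permutes_compose)
next
  case (perm \<pi> \<sigma>)
  have inv: "pair_perm \<tau> (pair_perm \<sigma>' k) = k" if "\<And>i. \<tau> (\<sigma>' i) = i" for \<tau> \<sigma>' k
    by (simp add: pair_perm_def that)
  have "bij (pair_perm \<sigma>)"
    by (rule o_bij[where g = "pair_perm (inv \<sigma>)"])
       (auto simp: fun_eq_iff permutes_inverses[OF perm.hyps(2)] intro!: inv)
  moreover have "pair_perm \<sigma> k = k" if "k \<notin> {..<2 * m}" for k
  proof -
    have "k div 2 \<notin> {..<m}" using that by auto
    then have "\<sigma> (k div 2) = k div 2" by (rule permutes_not_in[OF perm.hyps(2)])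
    then show ?thesis by (simp add: pair_perm_def)
  qed
  ultimately have "pair_perm \<sigma> permutes {..<2 * m}"
    by (auto simp: permutes_def bij_iff)
  then show ?case using perm.IH by (intro permutes_compose)
qed

lemma finite_elastic_perms: "finite (elastic_perms m)"
  by (rule finite_subset[OF _ finite_permutations[of "{..<2 * m}"]])
     (auto intro: elastic_perms_permutes)

definition elastic_sym :: "nat \<Rightarrow> 'n tensor \<Rightarrow> 'n tensor" where
  "elastic_sym m a is =
     (\<Sum>\<pi>\<in>elastic_perms m. a (permute_list \<pi> is)) / real (card (elastic_perms m))"

definition partial_deriv :: "'n \<Rightarrow> (real ^ 'n::finite \<Rightarrow> real) \<Rightarrow> real ^ 'n \<Rightarrow> real" where
  "partial_deriv j f x = deriv (\<lambda>t. f (x + t *\<^sub>R axis j 1)) 0"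

(* Differentiability of all iterated partial derivatives amounts to smoothness. *)

definition schwartz :: "(real ^ 'n::finite \<Rightarrow> real) \<Rightarrow> bool" where
  "schwartz f \<longleftrightarrow> (\<forall>js. (\<forall>x. foldr partial_deriv js f differentiable (at x)) \<and>
     (\<forall>k::nat. \<exists>C. \<forall>x. norm x ^ k * \<bar>foldr partial_deriv js f x\<bar> \<le> C))"

(* For a linear space E of tensors of a fixed rank, a field with values in E is a Schwartz
   function if and only if all its components are. *)

definition schwartz_fields :: "'n::finite tensor set \<Rightarrow> (real ^ 'n \<Rightarrow> 'n tensor) set" where
  "schwartz_fields E = {f. (\<forall>x. f x \<in> E) \<and> (\<forall>is. schwartz (\<lambda>x. f x is))}"

definition tensor_D :: "(real ^ 'n::finite \<Rightarrow> 'n tensor) \<Rightarrow> real ^ 'n \<Rightarrow> 'n tensor" where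
  "tensor_D f x is = (case is of [] \<Rightarrow> 0 | j # js \<Rightarrow> partial_deriv j (\<lambda>y. f y js) x)"

definition hess_potential ::
  "nat \<Rightarrow> (real ^ 'n::finite \<Rightarrow> 'n tensor) \<Rightarrow> real ^ 'n \<Rightarrow> 'n tensor" where
  "hess_potential m h x = elastic_sym m (tensor_D (tensor_D h) x)"

definition Q_set :: "real ^ 'n::finite \<Rightarrow> (real ^ 'n) set" where
  "Q_set v = range (\<lambda>c. c *\<^sub>R v) \<union> {q. orthogonal v q}"

(* The m-th tensor power of the tensor product of v and q. *)

definition elastic_power :: "nat \<Rightarrow> real ^ 'n::finite \<Rightarrow> real ^ 'n \<Rightarrow> 'n tensor" where
  "elastic_power m v q is =
     (if length is = 2 * m then \<Prod>r<m. v $ (is ! (2 * r)) * q $ (is ! (2 * r + 1)) else 0)"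

definition elastic_ray ::
  "nat \<Rightarrow> real ^ 'n::finite \<Rightarrow> real ^ 'n \<Rightarrow> (real ^ 'n \<Rightarrow> 'n tensor) \<Rightarrow> real ^ 'n \<Rightarrow> real" where
  "elastic_ray m v q f x =
     (LINT t|lborel. tensor_inner (2 * m) (f (x + t *\<^sub>R v)) (elastic_power m v q))"

definition elastic_ray_kernel :: "nat \<Rightarrow> (real ^ 'n::finite \<Rightarrow> 'n tensor) set" where
  "elastic_ray_kernel m = {f \<in> schwartz_fields (elastic_tensors m).
     \<forall>v \<in> sphere 0 1. \<forall>q \<in> Q_set v. \<forall>x. elastic_ray m v q f x = 0}"

end

theory Submission
  imports Defs "HOL-Probability.Sinc_Integral"
begin

text \<open>
  Moving the symmetrization onto the other factor of the inner product turns the integrand into an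
  average over index symmetries, each of which maps index pairs to index pairs. So one of the two
  indices of the Hessian is always contracted with \<open>v\<close>, and the other one with \<open>q\<close>. As partial
  derivatives commute, each term is then the derivative along the line, in direction \<open>v\<close>, of a
  Schwartz function, and its integral vanishes. The position of \<open>q\<close> relative to \<open>v\<close> plays no role.
\<close>

section \<open>Directional derivatives\<close>

text \<open>\<open>partial_deriv\<close> is a one-variable \<open>deriv\<close>; the chain rule
  along a coordinate axis identifies it with the total derivative at a basis vector, and linearity
  with the basis expansion of \<open>v\<close> gives the rest.\<close>

lemma has_derivative_partial_deriv:
  fixes f :: "real ^ 'n::finite \<Rightarrow> real"
  assumes "f differentiable (at x)"
  shows "(f has_derivative (\<lambda>v. \<Sum>j\<in>UNIV. v $ j * partial_deriv j f x)) (at x)"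
proof -
  obtain f' where f': "(f has_derivative f') (at x)"
    using assms by (auto simp: differentiable_def)
  interpret f': bounded_linear f' using f' by (rule has_derivative_bounded_linear)
  have partial: "partial_deriv j f x = f' (axis j 1)" for j
  proof -
    have "((\<lambda>t. x + t *\<^sub>R axis j 1) has_derivative (\<lambda>t. t *\<^sub>R axis j 1)) (at 0)"
      by (auto intro!: derivative_eq_intros)
    moreover have "(f has_derivative f') (at (x + 0 *\<^sub>R axis j 1))"
      using f' by simp
    ultimately have "((\<lambda>t. f (x + t *\<^sub>R axis j 1)) has_derivative (\<lambda>t. f' (t *\<^sub>R axis j 1))) (at 0)"
      by (rule has_derivative_compose)
    then have "((\<lambda>t. f (x + t *\<^sub>R axis j 1)) has_real_derivative f' (axis j 1)) (at 0)"
      by (simp add: has_field_derivative_def f'.scaleR mult_commute_abs)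
    then show ?thesis
      unfolding partial_deriv_def by (rule DERIV_imp_deriv)
  qed
  have "f' v = (\<Sum>j\<in>UNIV. v $ j * partial_deriv j f x)" for v
  proof -
    have "f' v = f' (\<Sum>j\<in>UNIV. v $ j *\<^sub>R axis j 1)"
      using basis_expansion[of v] by (simp add: scalar_mult_eq_scaleR)
    then show ?thesis by (simp add: f'.sum f'.scaleR partial)
  qed
  then have "f' = (\<lambda>v. \<Sum>j\<in>UNIV. v $ j * partial_deriv j f x)" by auto
  with f' show ?thesis by simp
qed

lemma has_real_derivative_along_line:
  fixes f :: "real ^ 'n::finite \<Rightarrow> real"
  assumes "f differentiable (at (x + t *\<^sub>R v))"
  shows "((\<lambda>t. f (x + t *\<^sub>R v)) has_real_derivative
    (\<Sum>j\<in>UNIV. v $ j * partial_deriv j f (x + t *\<^sub>R v))) (at t)"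
proof -
  have "((\<lambda>t. x + t *\<^sub>R v) has_derivative (\<lambda>t. t *\<^sub>R v)) (at t)"
    by (auto intro!: derivative_eq_intros)
  from has_derivative_compose[OF this has_derivative_partial_deriv[OF assms]]
  have "((\<lambda>t. f (x + t *\<^sub>R v)) has_derivative
    (\<lambda>s. s * (\<Sum>j\<in>UNIV. v $ j * partial_deriv j f (x + t *\<^sub>R v)))) (at t)"
    by (simp add: sum_distrib_left mult.assoc)
  then show ?thesis
    by (simp add: has_field_derivative_def mult_commute_abs)
qed

lemma has_real_derivative_axis:
  fixes f :: "real ^ 'n::finite \<Rightarrow> real"
  assumes "f differentiable (at (x + t *\<^sub>R axis i 1))"
  shows "((\<lambda>t. f (x + t *\<^sub>R axis i 1)) has_real_derivative
    partial_deriv i f (x + t *\<^sub>R axis i 1)) (at t)"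
proof -
  have "(\<Sum>j\<in>UNIV. axis i 1 $ j * partial_deriv j f y) = partial_deriv i f y" for y
    by (simp add: axis_def if_distrib[of "\<lambda>c. c * _"] sum.delta' cong: if_cong)
  then show ?thesis using has_real_derivative_along_line[OF assms] by simp
qed

lemma partial_deriv_linear_combination:
  fixes f :: "'a \<Rightarrow> real ^ 'n::finite \<Rightarrow> real"
  assumes "\<And>i. i \<in> I \<Longrightarrow> f i differentiable (at x)"
  shows "partial_deriv j (\<lambda>x. \<Sum>i\<in>I. c i * f i x) x = (\<Sum>i\<in>I. c i * partial_deriv j (f i) x)"
proof -
  have "((\<lambda>t. f i (x + t *\<^sub>R axis j 1)) has_real_derivative partial_deriv j (f i) x) (at 0)"
    if "i \<in> I" for i
    using has_real_derivative_axis[of "f i" x 0 j] assms[OF that] by simp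
  then have "((\<lambda>t. \<Sum>i\<in>I. c i * f i (x + t *\<^sub>R axis j 1)) has_real_derivative
      (\<Sum>i\<in>I. c i * partial_deriv j (f i) x)) (at 0)"
    by (intro DERIV_sum DERIV_cmult)
  then show ?thesis
    unfolding partial_deriv_def by (rule DERIV_imp_deriv)
qed

section \<open>Symmetry of second partial derivatives\<close>

text \<open>The mean value theorem is applied twice: in direction \<open>i\<close> to a difference
  of \<open>f\<close>, then in direction \<open>j\<close> to \<open>partial_deriv i f\<close>. The
  second difference on the left is symmetric in \<open>i\<close> and \<open>j\<close>, which makes
  it the link between the two mixed partials.\<close>

lemma second_difference_eq_partial_deriv:
  fixes f :: "real ^ 'n::finite \<Rightarrow> real"
  assumes f: "\<And>x. f differentiable (at x)"
    and fi: "\<And>x. partial_deriv i f differentiable (at x)"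
    and h: "h > 0"
  obtains s t where "0 < s" "s < h" "0 < t" "t < h"
    "f (x + h *\<^sub>R axis i 1 + h *\<^sub>R axis j 1) - f (x + h *\<^sub>R axis i 1) - f (x + h *\<^sub>R axis j 1) + f x =
      h * h * partial_deriv j (partial_deriv i f) (x + s *\<^sub>R axis i 1 + t *\<^sub>R axis j 1)"
proof -
  define a b :: "real ^ 'n" where "a = axis i 1" and "b = axis j 1"
  \<comment> \<open>The shift in direction \<open>j\<close> is built into \<open>u\<close>, so the
    second difference becomes the plain increment \<open>u h - u 0\<close>.\<close>
  define u where "u = (\<lambda>s. f (x + h *\<^sub>R b + s *\<^sub>R a) - f (x + s *\<^sub>R a))"
  have "(u has_real_derivative
      partial_deriv i f (x + h *\<^sub>R b + s *\<^sub>R a) - partial_deriv i f (x + s *\<^sub>R a)) (at s)" for s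
    unfolding u_def a_def by (intro DERIV_diff has_real_derivative_axis f)
  from MVT2[OF h this] obtain s where s: "0 < s" "s < h" and
    us: "u h - u 0 = h * (partial_deriv i f (x + h *\<^sub>R b + s *\<^sub>R a) - partial_deriv i f (x + s *\<^sub>R a))"
    by auto
  have "((\<lambda>t. partial_deriv i f (x + s *\<^sub>R a + t *\<^sub>R b)) has_real_derivative
      partial_deriv j (partial_deriv i f) (x + s *\<^sub>R a + t *\<^sub>R b)) (at t)" for t
    unfolding b_def by (intro has_real_derivative_axis fi)
  from MVT2[OF h this] obtain t where t: "0 < t" "t < h" and
    ut: "partial_deriv i f (x + s *\<^sub>R a + h *\<^sub>R b) - partial_deriv i f (x + s *\<^sub>R a + 0 *\<^sub>R b) =
      h * partial_deriv j (partial_deriv i f) (x + s *\<^sub>R a + t *\<^sub>R b)"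
    by auto
  have "f (x + h *\<^sub>R a + h *\<^sub>R b) - f (x + h *\<^sub>R a) - f (x + h *\<^sub>R b) + f x = u h - u 0"
    by (simp add: u_def algebra_simps)
  also have "\<dots> = h * h * partial_deriv j (partial_deriv i f) (x + s *\<^sub>R a + t *\<^sub>R b)"
    using us ut by (simp add: add_ac)
  finally show ?thesis using that s t unfolding a_def b_def by blast
qed

text \<open>Both mixed partials, each taken at some point near \<open>x\<close>, equal the same
  second difference divided by \<open>h * h\<close>. If they differed at \<open>x\<close>,
  continuity would keep these values apart.\<close>

lemma partial_deriv_commute:
  fixes f :: "real ^ 'n::finite \<Rightarrow> real"
  assumes f: "\<And>x. f differentiable (at x)"
    and f1: "\<And>i x. partial_deriv i f differentiable (at x)"
    and f2: "\<And>i j x. isCont (partial_deriv i (partial_deriv j f)) x"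
  shows "partial_deriv i (partial_deriv j f) x = partial_deriv j (partial_deriv i f) x"
proof (rule ccontr)
  let ?ij = "partial_deriv i (partial_deriv j f)" and ?ji = "partial_deriv j (partial_deriv i f)"
  assume ne: "?ij x \<noteq> ?ji x"
  \<comment> \<open>Half the gap: no common value can lie closer than \<open>e\<close> to both mixed
    partials at \<open>x\<close>.\<close>
  define e where "e = \<bar>?ij x - ?ji x\<bar> / 2"
  have "e > 0" using ne by (simp add: e_def)
  obtain d1 where d1: "d1 > 0" "\<And>y. dist y x < d1 \<Longrightarrow> \<bar>?ij y - ?ij x\<bar> < e"
    using f2[where i = i and j = j and x = x] \<open>e > 0\<close> unfolding continuous_at_eps_delta by (auto simp: dist_real_def)
  obtain d2 where d2: "d2 > 0" "\<And>y. dist y x < d2 \<Longrightarrow> \<bar>?ji y - ?ji x\<bar> < e"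
    using f2[where i = j and j = i and x = x] \<open>e > 0\<close> unfolding continuous_at_eps_delta by (auto simp: dist_real_def)
  \<comment> \<open>The points supplied by the mean value theorem lie closer than
    \<open>2 * h\<close> to \<open>x\<close>, and \<open>2 * h\<close> is the smaller of
    \<open>d1\<close> and \<open>d2\<close>.\<close>
  define h where "h = min d1 d2 / 2"
  have h: "h > 0" using d1 d2 by (simp add: h_def)
  obtain s t where st: "0 < s" "s < h" "0 < t" "t < h"
    and 1: "f (x + h *\<^sub>R axis i 1 + h *\<^sub>R axis j 1) - f (x + h *\<^sub>R axis i 1) - f (x + h *\<^sub>R axis j 1) + f x =
      h * h * ?ji (x + s *\<^sub>R axis i 1 + t *\<^sub>R axis j 1)"
    by (rule second_difference_eq_partial_deriv[OF f f1 h])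
  obtain s' t' where st': "0 < s'" "s' < h" "0 < t'" "t' < h"
    and 2: "f (x + h *\<^sub>R axis j 1 + h *\<^sub>R axis i 1) - f (x + h *\<^sub>R axis j 1) - f (x + h *\<^sub>R axis i 1) + f x =
      h * h * ?ij (x + s' *\<^sub>R axis j 1 + t' *\<^sub>R axis i 1)"
    by (rule second_difference_eq_partial_deriv[OF f f1 h])
  have near: "dist (x + s *\<^sub>R axis i 1 + t *\<^sub>R axis j 1) x < 2 * h"
    if "0 < s" "s < h" "0 < t" "t < h" for s t i j
  proof -
    have "norm (s *\<^sub>R axis i 1 + t *\<^sub>R (axis j 1 :: real ^ 'n)) \<le> s + t"
      using norm_triangle_ineq[of "s *\<^sub>R axis i 1" "t *\<^sub>R (axis j 1 :: real ^ 'n)"] that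
      by (simp add: norm_axis_1)
    then show ?thesis using that by (simp add: dist_norm add.assoc)
  qed
  \<comment> \<open>The symmetry enters here: the two second differences share their far corner, up
    to the order of addition.\<close>
  have "x + h *\<^sub>R axis j 1 + h *\<^sub>R axis i 1 = x + h *\<^sub>R axis i 1 + h *\<^sub>R axis j 1"
    by (simp add: add_ac)
  then have "f (x + h *\<^sub>R axis j 1 + h *\<^sub>R axis i 1) = f (x + h *\<^sub>R axis i 1 + h *\<^sub>R axis j 1)"
    by (rule arg_cong)
  then have "h * h * ?ji (x + s *\<^sub>R axis i 1 + t *\<^sub>R axis j 1) =
      h * h * ?ij (x + s' *\<^sub>R axis j 1 + t' *\<^sub>R axis i 1)"
    using 1 2 by linarith
  then have "?ji (x + s *\<^sub>R axis i 1 + t *\<^sub>R axis j 1) = ?ij (x + s' *\<^sub>R axis j 1 + t' *\<^sub>R axis i 1)"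
    using h by simp
  moreover have "\<bar>?ji (x + s *\<^sub>R axis i 1 + t *\<^sub>R axis j 1) - ?ji x\<bar> < e"
    using near[OF st, of i j] by (intro d2) (simp add: h_def)
  moreover have "\<bar>?ij (x + s' *\<^sub>R axis j 1 + t' *\<^sub>R axis i 1) - ?ij x\<bar> < e"
    using near[OF st', of j i] by (intro d1) (simp add: h_def)
  ultimately show False unfolding e_def by (simp add: abs_if split: if_splits)
qed

section \<open>Schwartz functions\<close>

lemma schwartz_differentiable: "schwartz f \<Longrightarrow> f differentiable (at x)"
  unfolding schwartz_def by (drule spec[of _ "[]"]) simp

lemma schwartz_isCont: "schwartz f \<Longrightarrow> isCont f x"
  by (intro differentiable_imp_continuous_within schwartz_differentiable)

lemma schwartz_decay:
  assumes "schwartz f"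
  obtains C where "\<And>x. norm x ^ k * \<bar>f x\<bar> \<le> C"
  using assms unfolding schwartz_def by (metis foldr_Nil id_apply)

text \<open>\<open>foldr\<close> applies the last entry of the list first, so differentiating
  \<open>f\<close> beforehand appends an index at the end of \<open>js\<close>.\<close>

lemma schwartz_partial_deriv:
  assumes "schwartz f"
  shows "schwartz (partial_deriv j f)"
proof -
  have "foldr partial_deriv js (partial_deriv j f) = foldr partial_deriv (js @ [j]) f" for js
    by simp
  then show ?thesis using assms unfolding schwartz_def by metis
qed

lemma schwartz_partial_deriv_commute:
  "schwartz f \<Longrightarrow> partial_deriv i (partial_deriv j f) x = partial_deriv j (partial_deriv i f) x"
  by (intro partial_deriv_commute schwartz_differentiable schwartz_isCont schwartz_partial_deriv)

text \<open>Iterated partial derivatives pass through the sum, after which the decay constants of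
  the terms add up with weights \<open>\<bar>c i\<bar>\<close>.\<close>

lemma schwartz_linear_combination:
  fixes f :: "'a \<Rightarrow> real ^ 'n::finite \<Rightarrow> real"
  assumes "\<And>i. i \<in> I \<Longrightarrow> schwartz (f i)"
  shows "schwartz (\<lambda>x. \<Sum>i\<in>I. c i * f i x)"
proof -
  have diff: "foldr partial_deriv js (f i) differentiable (at x)" if "i \<in> I" for i js x
    using assms[OF that] by (auto simp: schwartz_def)
  have eq: "foldr partial_deriv js (\<lambda>x. \<Sum>i\<in>I. c i * f i x) =
      (\<lambda>x. \<Sum>i\<in>I. c i * foldr partial_deriv js (f i) x)" for js
    by (induction js) (auto simp: partial_deriv_linear_combination diff)
  show ?thesis unfolding schwartz_def eq
  proof (intro allI conjI)
    fix js x
    show "(\<lambda>x. \<Sum>i\<in>I. c i * foldr partial_deriv js (f i) x) differentiable (at x)"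
    \<comment> \<open>Over an infinite \<open>I\<close> the sum is 0 by convention, hence a constant
      function.\<close>
    proof (cases "finite I")
      case True
      then show ?thesis by (intro differentiable_sum differentiable_mult differentiable_const) (auto simp: diff)
    qed simp
  next
    fix js and k :: nat
    have "\<forall>i\<in>I. \<exists>C. \<forall>x. norm x ^ k * \<bar>foldr partial_deriv js (f i) x\<bar> \<le> C"
      using assms by (auto simp: schwartz_def)
    then obtain C where C: "norm x ^ k * \<bar>foldr partial_deriv js (f i) x\<bar> \<le> C i" if "i \<in> I" for i x
      by metis
    have "norm x ^ k * \<bar>\<Sum>i\<in>I. c i * foldr partial_deriv js (f i) x\<bar> \<le> (\<Sum>i\<in>I. \<bar>c i\<bar> * C i)" for x
    proof -
      have "norm x ^ k * \<bar>\<Sum>i\<in>I. c i * foldr partial_deriv js (f i) x\<bar> \<le>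
          norm x ^ k * (\<Sum>i\<in>I. \<bar>c i * foldr partial_deriv js (f i) x\<bar>)"
        by (intro mult_left_mono sum_abs) auto
      also have "\<dots> = (\<Sum>i\<in>I. \<bar>c i\<bar> * (norm x ^ k * \<bar>foldr partial_deriv js (f i) x\<bar>))"
        by (simp add: sum_distrib_left abs_mult mult_ac)
      also have "\<dots> \<le> (\<Sum>i\<in>I. \<bar>c i\<bar> * C i)"
        by (intro sum_mono mult_left_mono C) auto
      finally show ?thesis .
    qed
    then show "\<exists>C. \<forall>x. norm x ^ k * \<bar>\<Sum>i\<in>I. c i * foldr partial_deriv js (f i) x\<bar> \<le> C" by blast
  qed
qed

lemma schwartz_zero: "schwartz (\<lambda>x. 0)"
  using schwartz_linear_combination[of "{}"] by simp

section \<open>Integrals along lines\<close>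

lemma schwartz_isCont_along_line:
  fixes f :: "real ^ 'n::finite \<Rightarrow> real"
  assumes "schwartz f"
  shows "isCont (\<lambda>t. f (x + t *\<^sub>R v)) t"
proof (rule isCont_o2[where g = f])
  show "isCont (\<lambda>t. x + t *\<^sub>R v) t" by (intro continuous_intros)
  show "isCont f (x + t *\<^sub>R v)" using assms by (rule schwartz_isCont)
qed

text \<open>Since \<open>v\<close> is a unit vector, \<open>\<bar>t\<bar>\<close> is at most the
  norm of the point on the line plus \<open>norm x\<close>, so decay of orders 0 and 2 turns into
  decay in \<open>t\<close>. The majorant serves two purposes: it tends to 0 at both ends, and it is
  integrable.\<close>

lemma schwartz_decay_along_line:
  fixes f :: "real ^ 'n::finite \<Rightarrow> real"
  assumes f: "schwartz f" and v: "norm v = 1"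
  obtains C where "\<And>t. \<bar>f (x + t *\<^sub>R v)\<bar> \<le> C * inverse (1 + t\<^sup>2)"
proof -
  obtain C0 where C0: "\<And>y. norm y ^ 0 * \<bar>f y\<bar> \<le> C0" using schwartz_decay[OF f] by blast
  obtain C2 where C2: "\<And>y. norm y ^ 2 * \<bar>f y\<bar> \<le> C2" using schwartz_decay[OF f] by blast
  \<comment> \<open>With \<open>y\<close> the point on the line, \<open>1 + t^2\<close> is at most
    \<open>1 + 2 * (norm x)^2 + 2 * (norm y)^2\<close>; after multiplication by
    \<open>\<bar>f y\<bar>\<close>, \<open>C0\<close> bounds the part free of \<open>norm y\<close>
    and \<open>C2\<close> the rest.\<close>
  define C where "C = (1 + 2 * (norm x)\<^sup>2) * C0 + 2 * C2"
  have "\<bar>f (x + t *\<^sub>R v)\<bar> \<le> C * inverse (1 + t\<^sup>2)" for t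
  proof -
    let ?y = "x + t *\<^sub>R v"
    have "\<bar>t\<bar> = norm (?y - x)" using v by simp
    then have "\<bar>t\<bar> \<le> norm ?y + norm x" by (metis norm_triangle_ineq4)
    then have "\<bar>t\<bar>\<^sup>2 \<le> (norm ?y + norm x)\<^sup>2" by (intro power_mono) auto
    \<comment> \<open>The difference of the two sides is the square of
      \<open>norm ?y - norm x\<close>.\<close>
    also have "\<dots> \<le> 2 * (norm ?y)\<^sup>2 + 2 * (norm x)\<^sup>2"
      using zero_le_power2[of "norm ?y - norm x"] by (simp add: power2_sum power2_diff)
    finally have "(1 + t\<^sup>2) * \<bar>f ?y\<bar> \<le> (1 + 2 * (norm ?y)\<^sup>2 + 2 * (norm x)\<^sup>2) * \<bar>f ?y\<bar>"
      by (intro mult_right_mono) auto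
    also have "\<dots> = (1 + 2 * (norm x)\<^sup>2) * \<bar>f ?y\<bar> + 2 * ((norm ?y)\<^sup>2 * \<bar>f ?y\<bar>)"
      by (simp add: algebra_simps)
    also have "\<dots> \<le> C"
      unfolding C_def using C0[of ?y] C2[of ?y] by (intro add_mono mult_left_mono) auto
    finally have "\<bar>f ?y\<bar> \<le> C / (1 + t\<^sup>2)"
      by (subst pos_le_divide_eq) (auto simp: mult.commute add_pos_nonneg)
    then show ?thesis by (simp add: field_simps)
  qed
  then show ?thesis by (rule that)
qed

lemma schwartz_tendsto_along_line:
  fixes f :: "real ^ 'n::finite \<Rightarrow> real"
  assumes "schwartz f" "norm v = 1"
  shows "((\<lambda>t. f (x + t *\<^sub>R v)) \<longlongrightarrow> 0) at_infinity"
proof -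
  obtain C where C: "\<And>t. \<bar>f (x + t *\<^sub>R v)\<bar> \<le> C * inverse (1 + t\<^sup>2)"
    using schwartz_decay_along_line[OF assms] by blast
  have "((\<lambda>t::real. C * inverse (1 + t\<^sup>2)) \<longlongrightarrow> 0) at_top"
    "((\<lambda>t::real. C * inverse (1 + t\<^sup>2)) \<longlongrightarrow> 0) at_bot" by real_asymp+
  then have "((\<lambda>t::real. C * inverse (1 + t\<^sup>2)) \<longlongrightarrow> 0) at_infinity"
    by (simp add: at_infinity_eq_at_top_bot filterlim_sup)
  then show ?thesis
    by (rule Lim_null_comparison[rotated]) (simp add: C)
qed

lemma schwartz_integrable_along_line:
  fixes f :: "real ^ 'n::finite \<Rightarrow> real"
  assumes "schwartz f" "norm v = 1"
  shows "integrable lborel (\<lambda>t. f (x + t *\<^sub>R v))"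
proof -
  obtain C where C: "\<And>t. \<bar>f (x + t *\<^sub>R v)\<bar> \<le> C * inverse (1 + t\<^sup>2)"
    using schwartz_decay_along_line[OF assms] by blast
  have "integrable lborel (\<lambda>t::real. inverse (1 + t\<^sup>2))"
    using integrable_inverse_1_plus_square by (simp add: set_integrable_def)
  then have "integrable lborel (\<lambda>t::real. C * inverse (1 + t\<^sup>2))" by simp
  moreover have "continuous_on UNIV (\<lambda>t. f (x + t *\<^sub>R v))"
    by (intro continuous_at_imp_continuous_on ballI schwartz_isCont_along_line assms)
  then have "(\<lambda>t. f (x + t *\<^sub>R v)) \<in> borel_measurable lborel"
    by (simp add: borel_measurable_continuous_onI)
  ultimately show ?thesis
    by (rule Bochner_Integration.integrable_bound) (use C in \<open>auto intro: order_trans[OF _ abs_ge_self]\<close>)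
qed

text \<open>By the fundamental theorem of calculus the integral is the difference of the limits of
  \<open>f\<close> at the two ends of the line, both 0. \<open>has_bochner_integral\<close> records
  integrability along with the value, so that sums and multiples can be formed later in one
  step.\<close>

lemma has_bochner_integral_directional_derivative:
  fixes f :: "real ^ 'n::finite \<Rightarrow> real"
  assumes f: "schwartz f" and v: "norm v = 1"
  shows "has_bochner_integral lborel (\<lambda>t. \<Sum>j\<in>UNIV. v $ j * partial_deriv j f (x + t *\<^sub>R v)) 0"
proof -
  let ?F = "\<lambda>t. f (x + t *\<^sub>R v)" and ?F' = "\<lambda>t. \<Sum>j\<in>UNIV. v $ j * partial_deriv j f (x + t *\<^sub>R v)"
  have int: "integrable lborel ?F'"
    by (intro Bochner_Integration.integrable_sum integrable_mult_right
        schwartz_integrable_along_line schwartz_partial_deriv f v)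
  have lim: "(?F \<longlongrightarrow> 0) at_top" "(?F \<longlongrightarrow> 0) at_bot"
    using schwartz_tendsto_along_line[OF f v, of x]
    by (auto intro: tendsto_mono[OF at_top_le_at_infinity] tendsto_mono[OF at_bot_le_at_infinity])
  have "(LBINT t=-\<infinity>..\<infinity>. ?F' t) = 0 - 0"
  proof (rule interval_integral_FTC_integrable[where F = ?F])
    show "(?F has_vector_derivative ?F' t) (at t)" for t
      using has_real_derivative_along_line[OF schwartz_differentiable[OF f]]
      by (simp add: has_real_derivative_iff_has_vector_derivative)
    show "isCont ?F' t" for t
      by (intro isCont_sum ballI isCont_mult continuous_const schwartz_isCont_along_line
          schwartz_partial_deriv f)
  qed (use int lim in \<open>auto simp: set_integrable_def ereal_tendsto_simps\<close>)
  then have "(LINT t|lborel. ?F' t) = 0"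
    by (simp add: interval_lebesgue_integral_def set_lebesgue_integral_def)
  with int show ?thesis by (simp add: has_bochner_integral_iff)
qed

text \<open>A Hessian contracted with \<open>v\<close> in one slot consists of derivatives along the
  line of Schwartz functions: directly if \<open>a = v\<close>, after exchanging the partial
  derivatives if \<open>b = v\<close>.\<close>

lemma has_bochner_integral_hessian:
  fixes f :: "real ^ 'n::finite \<Rightarrow> real"
  assumes f: "schwartz f" and v: "norm v = 1" and ab: "a = v \<or> b = v"
  shows "has_bochner_integral lborel
    (\<lambda>t. \<Sum>i\<in>UNIV. \<Sum>j\<in>UNIV. a $ i * b $ j * partial_deriv i (partial_deriv j f) (x + t *\<^sub>R v)) 0"
proof -
  \<comment> \<open>For fixed \<open>j\<close> the inner sum is the derivative in direction
    \<open>v\<close> of the Schwartz function \<open>partial_deriv j f\<close>.\<close>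
  have main: "has_bochner_integral lborel
      (\<lambda>t. \<Sum>j\<in>UNIV. c $ j * (\<Sum>i\<in>UNIV. v $ i * partial_deriv i (partial_deriv j f) (x + t *\<^sub>R v))) 0"
    for c :: "real ^ 'n"
  proof -
    have "has_bochner_integral lborel
      (\<lambda>t. \<Sum>j\<in>UNIV. c $ j * (\<Sum>i\<in>UNIV. v $ i * partial_deriv i (partial_deriv j f) (x + t *\<^sub>R v)))
      (\<Sum>j\<in>UNIV. c $ j * 0)"
      by (intro has_bochner_integral_sum has_bochner_integral_mult_right
          has_bochner_integral_directional_derivative schwartz_partial_deriv f v)
    then show ?thesis by simp
  qed
  from ab show ?thesis
  proof
    assume "a = v"
    with main[of b] show ?thesis
      by (subst sum.swap) (simp add: sum_distrib_left mult_ac)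
  next
    assume "b = v"
    with main[of a] show ?thesis
      by (subst schwartz_partial_deriv_commute[OF f]) (simp add: sum_distrib_left mult_ac)
  qed
qed

section \<open>Elastic symmetrization\<close>

lemma pair_swap_in_elastic_perms: "r < m \<Longrightarrow> pair_swap r \<in> elastic_perms m"
  using elastic_perms.swap[OF elastic_perms.id] by simp

lemma pair_perm_in_elastic_perms: "\<sigma> permutes {..<m} \<Longrightarrow> pair_perm \<sigma> \<in> elastic_perms m"
  using elastic_perms.perm[OF elastic_perms.id] by simp

text \<open>The introduction rules extend a permutation on the right, so the induction runs over the
  right factor.\<close>

lemma elastic_perms_comp:
  assumes "\<rho> \<in> elastic_perms m" "\<pi> \<in> elastic_perms m"
  shows "\<rho> \<circ> \<pi> \<in> elastic_perms m"
  using assms(2)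
proof induction
  case id
  show ?case using assms(1) by simp
next
  case (swap \<pi> r)
  then show ?case unfolding comp_assoc[symmetric] by (intro elastic_perms.swap)
next
  case (perm \<pi> \<sigma>)
  then show ?case unfolding comp_assoc[symmetric] by (intro elastic_perms.perm)
qed

text \<open>An injective self-map of a finite set is onto; this spares a separate proof of closure
  under inverses.\<close>

lemma bij_betw_elastic_perms_comp:
  assumes "\<rho> \<in> elastic_perms m"
  shows "bij_betw ((\<circ>) \<rho>) (elastic_perms m) (elastic_perms m)"
proof -
  have "inj \<rho>" using elastic_perms_permutes[OF assms] by (rule permutes_inj)
  then have inj: "inj_on ((\<circ>) \<rho>) (elastic_perms m)"
    by (intro inj_on_subset[OF fun.inj_map]) auto
  moreover have "(\<circ>) \<rho> ` elastic_perms m \<subseteq> elastic_perms m"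
    using elastic_perms_comp[OF assms] by auto
  ultimately show ?thesis
    by (simp add: bij_betw_def endo_inj_surj finite_elastic_perms)
qed

text \<open>\<open>permute_list\<close> reverses composition: permuting by \<open>\<rho>\<close> and
  then by \<open>\<pi>\<close> is permuting by \<open>\<rho> \<circ> \<pi>\<close>. So the average
  is merely reindexed by a left translation.\<close>

lemma elastic_sym_permute:
  assumes \<rho>: "\<rho> \<in> elastic_perms m" and len: "length is = 2 * m"
  shows "elastic_sym m a (permute_list \<rho> is) = elastic_sym m a is"
proof -
  have "(\<Sum>\<pi>\<in>elastic_perms m. a (permute_list \<pi> (permute_list \<rho> is))) =
      (\<Sum>\<pi>\<in>elastic_perms m. a (permute_list (\<rho> \<circ> \<pi>) is))"
    using len by (intro sum.cong refl) (simp add: permute_list_compose elastic_perms_permutes)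
  also have "\<dots> = (\<Sum>\<pi>\<in>elastic_perms m. a (permute_list \<pi> is))"
    by (rule sum.reindex_bij_betw[OF bij_betw_elastic_perms_comp[OF \<rho>]])
  finally show ?thesis by (simp add: elastic_sym_def)
qed

lemma elastic_sym_in_elastic_tensors:
  assumes "a \<in> tensors (2 * m)"
  shows "elastic_sym m a \<in> elastic_tensors m"
  unfolding elastic_tensors_def
proof (intro CollectI conjI allI impI)
  show "elastic_sym m a \<in> tensors (2 * m)"
    using assms by (auto simp: tensors_def elastic_sym_def)
qed (simp_all add: elastic_sym_permute pair_swap_in_elastic_perms pair_perm_in_elastic_perms)

text \<open>A swap stays inside its pair and \<open>pair_perm\<close> moves pairs as wholes. The
  generator acts before \<open>\<pi>\<close>, hence the induction is for arbitrary \<open>k\<close>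
  and \<open>l\<close>.\<close>

lemma elastic_perms_same_pair:
  assumes "\<pi> \<in> elastic_perms m" "k div 2 = l div 2"
  shows "\<pi> k div 2 = \<pi> l div 2"
  using assms
proof (induction arbitrary: k l)
  case (swap \<pi> r)
  have "pair_swap r n div 2 = n div 2" for n
    by (simp add: pair_swap_def Transposition.transpose_def)
  then have "pair_swap r k div 2 = pair_swap r l div 2" using swap.prems by simp
  from swap.IH[OF this] show ?case by simp
next
  case (perm \<pi> \<sigma>)
  have "pair_perm \<sigma> n div 2 = \<sigma> (n div 2)" for n
    by (simp add: pair_perm_def)
  then have "pair_perm \<sigma> k div 2 = pair_perm \<sigma> l div 2" using perm.prems by simp
  from perm.IH[OF this] show ?case by simp
qed simp

text \<open>Positions 0 and 1 hold the two derivative indices of the Hessian. Their images are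
  distinct and form one index pair, which has an even member, and even positions of the elastic
  power carry \<open>v\<close>.\<close>

lemma elastic_perms_first_pair:
  assumes "\<pi> \<in> elastic_perms m"
  shows "even (\<pi> 0) \<or> even (\<pi> 1)"
proof (rule ccontr)
  assume "\<not> ?thesis"
  then have "\<pi> 0 = 2 * (\<pi> 0 div 2) + 1" "\<pi> 1 = 2 * (\<pi> 1 div 2) + 1"
    by simp_all
  moreover have "\<pi> 0 div 2 = \<pi> 1 div 2" using assms by (rule elastic_perms_same_pair) simp
  ultimately have "\<pi> 0 = \<pi> 1" by linarith
  moreover have "inj \<pi>" using elastic_perms_permutes[OF assms] by (rule permutes_inj)
  ultimately show False using injD[of \<pi> 0 1] by simp
qed

section \<open>Inner product of a symmetrization with an elastic power\<close>

lemma elastic_power_alt: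
  assumes "length is = 2 * m"
  shows "elastic_power m v q is = (\<Prod>k<2 * m. (if even k then v else q) $ (is ! k))"
proof -
  have "(\<Prod>k<2 * n. (if even k then v else q) $ (is ! k)) =
      (\<Prod>r<n. v $ (is ! (2 * r)) * q $ (is ! (2 * r + 1)))" for n
    by (induction n) auto
  then show ?thesis using assms by (simp add: elastic_power_def)
qed

lemma bij_betw_permute_list:
  assumes "\<pi> permutes {..<n}"
  shows "bij_betw (permute_list \<pi>) {is. length is = n} {is. length is = n}"
proof (rule bij_betwI[where g = "permute_list (inv \<pi>)"])
  have inv: "inv \<pi> permutes {..<n}" using assms by (rule permutes_inv)
  show "permute_list (inv \<pi>) (permute_list \<pi> is) = is" if "is \<in> {is. length is = n}" for "is"
    using permute_list_compose[of "inv \<pi>" "is" \<pi>] that inv by (simp add: permutes_inv_o[OF assms])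
  show "permute_list \<pi> (permute_list (inv \<pi>) is) = is" if "is \<in> {is. length is = n}" for "is"
    using permute_list_compose[of \<pi> "is" "inv \<pi>"] that assms by (simp add: permutes_inv_o[OF assms])
qed auto

text \<open>Adjointness of index permutation: substituting \<open>permute_list \<pi> is\<close> for
  the summation index frees \<open>a\<close> from the permutation and passes it to the
  vectors.\<close>

lemma sum_permute_list_prod:
  fixes a :: "'n::finite tensor" and w :: "nat \<Rightarrow> real ^ 'n"
  assumes \<pi>: "\<pi> permutes {..<n}"
  shows "(\<Sum>is | length is = n. a (permute_list \<pi> is) * (\<Prod>k<n. w k $ (is ! k))) =
    (\<Sum>is | length is = n. a is * (\<Prod>k<n. w (\<pi> k) $ (is ! k)))"
proof -
  \<comment> \<open>Reordering the factors by \<open>\<pi>\<close> makes \<open>is\<close> occur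
    only through \<open>permute_list \<pi> is\<close>, as the substitution requires.\<close>
  have "(\<Prod>k<n. w k $ (is ! k)) = (\<Prod>k<n. w (\<pi> k) $ (permute_list \<pi> is ! k))" if "length is = n" for "is"
    using that \<pi> prod.permute[OF \<pi>, of "\<lambda>k. w k $ (is ! k)"] by (simp add: permute_list_nth)
  then have "(\<Sum>is | length is = n. a (permute_list \<pi> is) * (\<Prod>k<n. w k $ (is ! k))) =
    (\<Sum>is | length is = n. a (permute_list \<pi> is) * (\<Prod>k<n. w (\<pi> k) $ (permute_list \<pi> is ! k)))"
    by (intro sum.cong) auto
  also have "\<dots> = (\<Sum>is | length is = n. a is * (\<Prod>k<n. w (\<pi> k) $ (is ! k)))"
    by (rule sum.reindex_bij_betw[OF bij_betw_permute_list[OF \<pi>]])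
  finally show ?thesis .
qed

lemma tensor_inner_elastic_sym:
  fixes a :: "'n::finite tensor"
  shows "tensor_inner (2 * m) (elastic_sym m a) (elastic_power m v q) =
    (\<Sum>\<pi>\<in>elastic_perms m. \<Sum>is | length is = 2 * m.
      a is * (\<Prod>k<2 * m. (if even (\<pi> k) then v else q) $ (is ! k))) / real (card (elastic_perms m))"
proof -
  have "tensor_inner (2 * m) (elastic_sym m a) (elastic_power m v q) =
    (\<Sum>is | length is = 2 * m. \<Sum>\<pi>\<in>elastic_perms m.
      a (permute_list \<pi> is) * (\<Prod>k<2 * m. (if even k then v else q) $ (is ! k))) /
    real (card (elastic_perms m))"
    by (simp add: tensor_inner_def elastic_sym_def elastic_power_alt sum_divide_distrib sum_distrib_right)
  also have "\<dots> = (\<Sum>\<pi>\<in>elastic_perms m. \<Sum>is | length is = 2 * m.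
      a (permute_list \<pi> is) * (\<Prod>k<2 * m. (if even k then v else q) $ (is ! k))) /
    real (card (elastic_perms m))"
    by (subst sum.swap) (rule refl)
  also have "\<dots> = (\<Sum>\<pi>\<in>elastic_perms m. \<Sum>is | length is = 2 * m.
      a is * (\<Prod>k<2 * m. (if even (\<pi> k) then v else q) $ (is ! k))) / real (card (elastic_perms m))"
    by (intro arg_cong2[where f = "(/)"] sum.cong refl sum_permute_list_prod elastic_perms_permutes)
  finally show ?thesis .
qed

section \<open>Components of the Hessian field\<close>

lemma sum_lists_length_Suc:
  fixes g :: "'n::finite list \<Rightarrow> real"
  shows "(\<Sum>is | length is = Suc n. g is) = (\<Sum>i\<in>UNIV. \<Sum>is | length is = n. g (i # is))"
proof -
  have "(\<Sum>i\<in>UNIV. \<Sum>is | length is = n. g (i # is)) =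
      (\<Sum>(i, is)\<in>UNIV \<times> {is. length is = n}. g (i # is))"
    by (rule sum.cartesian_product)
  also have "\<dots> = (\<Sum>is | length is = Suc n. g is)"
    by (rule sum.reindex_bij_witness[where i = "\<lambda>is. (hd is, tl is)" and j = "\<lambda>(i, is). i # is"])
       (auto simp: length_Suc_conv)
  finally show ?thesis by simp
qed

lemma tensor_D_D_Cons_Cons:
  "tensor_D (tensor_D h) x (i # j # is) = partial_deriv i (partial_deriv j (\<lambda>y. h y is)) x"
proof -
  have "(\<lambda>y. tensor_D h y (j # is)) = partial_deriv j (\<lambda>y. h y is)"
    by (simp add: tensor_D_def fun_eq_iff)
  then show ?thesis by (simp add: tensor_D_def[of "tensor_D h"])
qed

lemma partial_deriv_zero: "partial_deriv j (\<lambda>x. 0) = (\<lambda>x. 0)"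
  by (simp add: partial_deriv_def fun_eq_iff)

text \<open>Components at lists of the wrong length are identically zero, and so are their
  derivatives; the empty list is covered by the default value 0 in \<open>tensor_D\<close>.\<close>

lemma tensor_D_tensors:
  assumes "\<And>y. h y \<in> tensors r"
  shows "tensor_D h x \<in> tensors (Suc r)"
proof -
  have "(\<lambda>y. h y is) = (\<lambda>y. 0)" if "length is \<noteq> r" for "is"
    using assms that by (auto simp: tensors_def)
  then show ?thesis
    by (auto simp: tensors_def tensor_D_def partial_deriv_zero split: list.split)
qed

lemma schwartz_tensor_D:
  assumes "\<And>is. schwartz (\<lambda>x. h x is)"
  shows "schwartz (\<lambda>x. tensor_D h x is)"
  by (cases "is") (simp_all add: tensor_D_def schwartz_zero schwartz_partial_deriv assms)

lemma hess_potential_in_schwartz_fields: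
  assumes m: "m \<ge> 1" and h: "h \<in> schwartz_fields (elastic_tensors (m - 1))"
  shows "hess_potential m h \<in> schwartz_fields (elastic_tensors m)"
proof -
  have "h y \<in> tensors (2 * (m - 1))" for y
    using h by (auto simp: schwartz_fields_def elastic_tensors_def)
  then have "tensor_D (tensor_D h) x \<in> tensors (Suc (Suc (2 * (m - 1))))" for x
    by (intro tensor_D_tensors)
  \<comment> \<open>Here \<open>m \<ge> 1\<close> matters: subtraction on naturals is truncated at
    \<open>m = 0\<close>.\<close>
  moreover have "Suc (Suc (2 * (m - 1))) = 2 * m" using m by simp
  ultimately have "hess_potential m h x \<in> elastic_tensors m" for x
    unfolding hess_potential_def by (metis elastic_sym_in_elastic_tensors)
  moreover have "schwartz (\<lambda>x. hess_potential m h x is)" for "is"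
  proof -
    \<comment> \<open>The division by the group order is written as a constant coefficient, to fit
      the form of a linear combination.\<close>
    have "schwartz (\<lambda>x. \<Sum>\<pi>\<in>elastic_perms m. inverse (real (card (elastic_perms m))) *
        tensor_D (tensor_D h) x (permute_list \<pi> is))"
      using h by (intro schwartz_linear_combination schwartz_tensor_D) (auto simp: schwartz_fields_def)
    then show ?thesis
      by (simp add: hess_potential_def elastic_sym_def divide_inverse mult.commute sum_distrib_left)
  qed
  ultimately show ?thesis by (simp add: schwartz_fields_def)
qed

text \<open>For each symmetry \<open>\<pi>\<close> and each fixed list of the remaining indices, the
  integrand is a constant times a Hessian of one component of \<open>h\<close>, contracted with
  \<open>v\<close> in at least one slot.\<close>

lemma elastic_ray_hess_potential:
  fixes h :: "real ^ 'n::finite \<Rightarrow> 'n tensor"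
  assumes m: "m \<ge> 1" and h: "\<And>is. schwartz (\<lambda>x. h x is)" and v: "norm v = 1"
  shows "elastic_ray m v q (hess_potential m h) x = 0"
proof -
  \<comment> \<open>\<open>l\<close> is the rank of \<open>h\<close>, the number of indices left
    once the two derivative indices are split off.\<close>
  obtain l where l: "2 * m = Suc (Suc l)" using m by (cases m) auto
  \<comment> \<open>\<open>w \<pi> k\<close> is the vector that meets the index at position
    \<open>k\<close> once \<open>\<pi>\<close> has been moved onto the elastic power.\<close>
  define w where "w = (\<lambda>\<pi> k :: nat. if even (\<pi> k :: nat) then v else q)"
  have "has_bochner_integral lborel
    (\<lambda>t. \<Sum>is | length is = l. (\<Prod>k<l. w \<pi> (Suc (Suc k)) $ (is ! k)) *
      (\<Sum>i\<in>UNIV. \<Sum>j\<in>UNIV. w \<pi> 0 $ i * w \<pi> 1 $ j *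
         partial_deriv i (partial_deriv j (\<lambda>y. h y is)) (x + t *\<^sub>R v)))
    (\<Sum>is | length is = l. (\<Prod>k<l. w \<pi> (Suc (Suc k)) $ (is ! k)) * 0)"
    if "\<pi> \<in> elastic_perms m" for \<pi>
    using elastic_perms_first_pair[OF that]
    by (intro has_bochner_integral_sum has_bochner_integral_mult_right has_bochner_integral_hessian h v)
       (auto simp: w_def)
  moreover have "(\<Sum>is | length is = 2 * m. tensor_D (tensor_D h) y is * (\<Prod>k<2 * m. w \<pi> k $ (is ! k))) =
    (\<Sum>is | length is = l. (\<Prod>k<l. w \<pi> (Suc (Suc k)) $ (is ! k)) *
      (\<Sum>i\<in>UNIV. \<Sum>j\<in>UNIV. w \<pi> 0 $ i * w \<pi> 1 $ j *
         partial_deriv i (partial_deriv j (\<lambda>y. h y is)) y))" for \<pi> y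
  proof -
    \<comment> \<open>Two indices are peeled off the list and two factors off the product; the
      exchanges of sums that follow bring the remaining indices to the outside.\<close>
    have "(\<Sum>is | length is = 2 * m. tensor_D (tensor_D h) y is * (\<Prod>k<2 * m. w \<pi> k $ (is ! k))) =
      (\<Sum>i\<in>UNIV. \<Sum>j\<in>UNIV. \<Sum>is | length is = l. (\<Prod>k<l. w \<pi> (Suc (Suc k)) $ (is ! k)) *
        (w \<pi> 0 $ i * w \<pi> 1 $ j * partial_deriv i (partial_deriv j (\<lambda>y. h y is)) y))"
      unfolding l sum_lists_length_Suc tensor_D_D_Cons_Cons prod.lessThan_Suc_shift
      by (simp add: mult_ac)
    also have "\<dots> = (\<Sum>i\<in>UNIV. \<Sum>is | length is = l. \<Sum>j\<in>UNIV. (\<Prod>k<l. w \<pi> (Suc (Suc k)) $ (is ! k)) *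
        (w \<pi> 0 $ i * w \<pi> 1 $ j * partial_deriv i (partial_deriv j (\<lambda>y. h y is)) y))"
      by (intro sum.cong refl sum.swap)
    also have "\<dots> = (\<Sum>is | length is = l. \<Sum>i\<in>UNIV. \<Sum>j\<in>UNIV. (\<Prod>k<l. w \<pi> (Suc (Suc k)) $ (is ! k)) *
        (w \<pi> 0 $ i * w \<pi> 1 $ j * partial_deriv i (partial_deriv j (\<lambda>y. h y is)) y))"
      by (rule sum.swap)
    finally show ?thesis by (simp add: sum_distrib_left)
  qed
  ultimately have "has_bochner_integral lborel
      (\<lambda>t. (\<Sum>\<pi>\<in>elastic_perms m. \<Sum>is | length is = 2 * m.
        tensor_D (tensor_D h) (x + t *\<^sub>R v) is * (\<Prod>k<2 * m. w \<pi> k $ (is ! k))) /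
        real (card (elastic_perms m)))
      ((\<Sum>\<pi>\<in>elastic_perms m. 0) / real (card (elastic_perms m)))"
    by (intro has_bochner_integral_divide has_bochner_integral_sum) simp
  then show ?thesis
    by (simp add: elastic_ray_def hess_potential_def tensor_inner_elastic_sym w_def has_bochner_integral_iff)
qed

theorem proposition4:
  fixes m :: nat
  assumes "m \<ge> 1"
  shows "hess_potential m `
      schwartz_fields (elastic_tensors (m - 1) :: 'n::finite tensor set)
    \<subseteq> elastic_ray_kernel m"
proof safe
  fix h :: "real ^ 'n \<Rightarrow> 'n tensor"
  assume h: "h \<in> schwartz_fields (elastic_tensors (m - 1))"
  have "elastic_ray m v q (hess_potential m h) x = 0" if "norm v = 1" for v q x
    using h that by (intro elastic_ray_hess_potential assms) (auto simp: schwartz_fields_def)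
  then show "hess_potential m h \<in> elastic_ray_kernel m"
    using hess_potential_in_schwartz_fields[OF assms h] by (simp add: elastic_ray_kernel_def)
qed

end
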